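(* Let $G$ be a graph of order $n$ with vertex set $V(G)=\{v_1,v_2,\ldots,v_n\}$, and let $H_1,H_2,\ldots,H_n$ be $n$ graphs (not necessarily non-isomorphic) of orders $t_1,t_2,\ldots,t_n$, respectively. Then, for any real $\alpha\in[0,1]$, the $A_\alpha$-characteristic polynomial of the generalized corona $G\tilde{o}\wedge_{i=1}^n H_i$ is $$f_{A_\alpha(G\tilde{o}\wedge_{i=1}^n H_i)}(\lambda)=\prod_{i=1}^n f_{A_\alpha(H_i)}(\lambda-\alpha)\cdot g_{A_\alpha}\big(\chi_{A_\alpha(H_1)}(\lambda),\chi_{A_\alpha(H_2)}(\lambda),\ldots,\chi_{A_\alpha(H_n)}(\lambda);G\big).$$
   Context: All graphs are finite, simple and undirected. For a graph $G$ with adjacency matrix $A(G)$ and diagonal degree matrix $D(G)$, and real $\alpha\in[0,1]$, $A_\alpha(G)=\alpha D(G)+(1-\alpha)A(G)$. For a square matrix $U$ of order $n$, $f_U(\lambda)=\det(\lambda I_n-U)$. The generalized corona $G\tilde{o}\wedge_{i=1}^n H_i$ (where $n=|V(G)|$) is the graph obtained by taking one copy of each of $G,H_1,\ldots,H_n$ (pairwise disjoint) and joining the $i$th vertex $v_i$ of $G$ to every vertex of $H_i$, for $1\le i\le n$. The $A_\alpha$-coronal of a graph $H$ of order $t$ is $\chi_{A_\alpha(H)}(\lambda)=\mathbf{1}_t^T\big((\lambda-\alpha)I_t-A_\alpha(H)\big)^{-1}\mathbf{1}_t$, where $\mathbf{1}_t$ is the all-ones column vector; it is a rational function of $\lambda$.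 For graphs $H_i$ of order $t_i$, $$g_{A_\alpha}\big(\chi_{A_\alpha(H_1)}(\lambda),\ldots,\chi_{A_\alpha(H_n)}(\lambda);G\big)=\det\Big(\mathrm{diag}\big(\lambda-\alpha t_1-(1-\alpha)^2\chi_{A_\alpha(H_1)}(\lambda),\ldots,\lambda-\alpha t_n-(1-\alpha)^2\chi_{A_\alpha(H_n)}(\lambda)\big)-A_\alpha(G)\Big).$$ Identities are identities of rational functions in $\lambda$. *)

theory Defs
  imports
    "Graph_Theory.Pair_Digraph"
    "Jordan_Normal_Form.Char_Poly"
    "Jordan_Normal_Form.Gauss_Jordan_Elimination"
    "HOL-Computational_Algebra.Fraction_Field"
    "HOL-Computational_Algebra.Polynomial_Factorial"
begin

text \<open>
  Finite simple undirected graphs are the symmetric loopfree finite pair digraphs of the locale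
  \<^locale>\<open>pair_graph\<close>: an undirected edge \<open>uv\<close> is represented by the two arcs \<open>(u,v)\<close> and \<open>(v,u)\<close>.
  Matrices of a graph are taken with respect to an explicit enumeration of its vertices.
\<close>

definition vertex_enum :: "'a pair_pre_digraph \<Rightarrow> 'a list \<Rightarrow> bool" where
  "vertex_enum G vs \<longleftrightarrow> distinct vs \<and> set vs = pverts G"

definition adjacency_mat :: "'a pair_pre_digraph \<Rightarrow> 'a list \<Rightarrow> real mat" where
  "adjacency_mat G vs = mat (length vs) (length vs)
     (\<lambda>(i, j). if (vs ! i, vs ! j) \<in> parcs G then 1 else 0)"

text \<open>In a symmetric digraph the out-degree of a vertex is its degree as an undirected graph.\<close>

definition degree_mat :: "'a pair_pre_digraph \<Rightarrow> 'a list \<Rightarrow> real mat" where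
  "degree_mat G vs = mat_diag (length vs) (\<lambda>i. real (out_degree (with_proj G) (vs ! i)))"

definition A_alpha :: "real \<Rightarrow> 'a pair_pre_digraph \<Rightarrow> 'a list \<Rightarrow> real mat" where
  "A_alpha \<alpha> G vs = \<alpha> \<cdot>\<^sub>m degree_mat G vs + (1 - \<alpha>) \<cdot>\<^sub>m adjacency_mat G vs"

text \<open>
  The vertices \<open>Inl v\<close> form the copy of \<open>G\<close>, the vertices \<open>Inr (i, x)\<close> the copy of \<open>H i\<close>, so that
  the copies are disjoint even if the given graphs share vertices. Indices start at 0.
\<close>

definition generalized_corona ::
  "'a pair_pre_digraph \<Rightarrow> 'a list \<Rightarrow> (nat \<Rightarrow> 'b pair_pre_digraph) \<Rightarrow> ('a + nat \<times> 'b) pair_pre_digraph"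
where
  "generalized_corona G vs H =
     \<lparr> pverts = Inl ` pverts G \<union> {Inr (i, x) | i x. i < length vs \<and> x \<in> pverts (H i)},
       parcs = {(Inl u, Inl v) | u v. (u, v) \<in> parcs G}
             \<union> {(Inr (i, x), Inr (i, y)) | i x y. i < length vs \<and> (x, y) \<in> parcs (H i)}
             \<union> {(Inl (vs ! i), Inr (i, x)) | i x. i < length vs \<and> x \<in> pverts (H i)}
             \<union> {(Inr (i, x), Inl (vs ! i)) | i x. i < length vs \<and> x \<in> pverts (H i)} \<rparr>"

text \<open>The field \<open>\<real>(\<lambda>)\<close> of rational functions is \<^typ>\<open>real poly fract\<close>.\<close>

type_synonym ratfun = "real poly fract"

definition rf_var :: ratfun where
  "rf_var = to_fract [:0, 1:]"

definition rf_const :: "real \<Rightarrow> ratfun" where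
  "rf_const c = to_fract [:c:]"

definition all_ones :: "nat \<Rightarrow> ratfun vec" where
  "all_ones t = vec t (\<lambda>_. 1)"

definition shifted_char_mat :: "real \<Rightarrow> 'a pair_pre_digraph \<Rightarrow> 'a list \<Rightarrow> ratfun mat" where
  "shifted_char_mat \<alpha> H ws =
     (rf_var - rf_const \<alpha>) \<cdot>\<^sub>m 1\<^sub>m (length ws) - map_mat rf_const (A_alpha \<alpha> H ws)"

text \<open>
  The inverse is taken over the field of rational functions, where it always exists
  (lemma \<open>mat_inverse_shifted_char_mat\<close>).
\<close>

definition coronal :: "real \<Rightarrow> 'a pair_pre_digraph \<Rightarrow> 'a list \<Rightarrow> ratfun" where
  "coronal \<alpha> H ws =
     all_ones (length ws) \<bullet> (the (mat_inverse (shifted_char_mat \<alpha> H ws)) *\<^sub>v all_ones (length ws))"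

text \<open>The \<open>i\<close>-th coronal enters as the value \<open>\<chi> i\<close>, the order of \<open>H i\<close> as \<open>t i\<close>.\<close>

definition g_A_alpha ::
  "real \<Rightarrow> (nat \<Rightarrow> nat) \<Rightarrow> (nat \<Rightarrow> ratfun) \<Rightarrow> 'a pair_pre_digraph \<Rightarrow> 'a list \<Rightarrow> ratfun"
where
  "g_A_alpha \<alpha> t \<chi> G vs = det
     (mat_diag (length vs)
        (\<lambda>i. rf_var - rf_const \<alpha> * of_nat (t i) - (1 - rf_const \<alpha>)\<^sup>2 * \<chi> i)
      - map_mat rf_const (A_alpha \<alpha> G vs))"

lemma A_alpha_carrier [simp]: "A_alpha \<alpha> G vs \<in> carrier_mat (length vs) (length vs)"
  by (simp add: A_alpha_def degree_mat_def adjacency_mat_def)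

lemma pair_graph_generalized_corona:
  assumes "pair_graph G" and "vertex_enum G vs" and "\<And>i. i < length vs \<Longrightarrow> pair_graph (H i)"
  shows "pair_graph (generalized_corona G vs H)"
proof -
  let ?C = "generalized_corona G vs H"
  interpret G: pair_graph G by fact
  have H: "x \<in> pverts (H i)" "y \<in> pverts (H i)" "x \<noteq> y" "(y, x) \<in> parcs (H i)"
    if i: "i < length vs" and xy: "(x, y) \<in> parcs (H i)" for i x y
  proof -
    interpret h: pair_graph "H i" using assms(3)[OF i] .
    show "x \<in> pverts (H i)" "y \<in> pverts (H i)" "x \<noteq> y" "(y, x) \<in> parcs (H i)"
      using xy h.in_arcsD1 h.in_arcsD2 h.pair_no_loops[OF xy] symD[OF h.pair_sym_arcs[unfolded symmetric_def], of x y]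
      by simp_all
  qed
  have G': "u \<in> pverts G" "v \<in> pverts G" "u \<noteq> v" "(v, u) \<in> parcs G" if uv: "(u, v) \<in> parcs G" for u v
    using uv G.in_arcsD1 G.in_arcsD2 G.pair_no_loops[OF uv] symD[OF G.pair_sym_arcs[unfolded symmetric_def], of u v]
    by simp_all
  have vs: "vs ! i \<in> pverts G" if "i < length vs" for i
    using assms(2) nth_mem[OF that] by (simp add: vertex_enum_def)
  have eq: "{Inr (i, x) | i x. i < length vs \<and> x \<in> pverts (H i)}
      = (\<Union>i<length vs. (\<lambda>x. Inr (i, x)) ` pverts (H i))"
    by blast
  have "finite (pverts (H i))" if "i < length vs" for i
  proof -
    interpret h: pair_graph "H i" using assms(3)[OF that] .
    show ?thesis by (rule h.pair_finite_verts)
  qed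
  then have finV: "finite (pverts ?C)"
    unfolding generalized_corona_def eq by (simp add: G.pair_finite_verts)
  have wf: "a \<in> pverts ?C" "b \<in> pverts ?C" and loop: "a \<noteq> b" and sym: "(b, a) \<in> parcs ?C"
    if "(a, b) \<in> parcs ?C" for a b
  proof -
    have "a \<in> pverts ?C \<and> b \<in> pverts ?C \<and> a \<noteq> b \<and> (b, a) \<in> parcs ?C"
    proof -
      have "(\<exists>u v. a = Inl u \<and> b = Inl v \<and> (u, v) \<in> parcs G)
        \<or> (\<exists>i x y. a = Inr (i, x) \<and> b = Inr (i, y) \<and> i < length vs \<and> (x, y) \<in> parcs (H i))
        \<or> (\<exists>i x. a = Inl (vs ! i) \<and> b = Inr (i, x) \<and> i < length vs \<and> x \<in> pverts (H i))
        \<or> (\<exists>i x. a = Inr (i, x) \<and> b = Inl (vs ! i) \<and> i < length vs \<and> x \<in> pverts (H i))"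
        using that by (simp add: generalized_corona_def)
      then show ?thesis
      proof (elim disjE exE conjE)
        fix u v
        assume "a = Inl u" "b = Inl v" and uv: "(u, v) \<in> parcs G"
        with G'[OF uv] show ?thesis by (simp add: generalized_corona_def)
      next
        fix i x y
        assume "a = Inr (i, x)" "b = Inr (i, y)" and xy: "i < length vs" "(x, y) \<in> parcs (H i)"
        with H[OF xy] show ?thesis by (simp add: generalized_corona_def)
      next
        fix i x
        assume "a = Inl (vs ! i)" "b = Inr (i, x)" and i: "i < length vs" and "x \<in> pverts (H i)"
        with vs[OF i] show ?thesis by (auto simp: generalized_corona_def)
      next
        fix i x
        assume "a = Inr (i, x)" "b = Inl (vs ! i)" and i: "i < length vs" and "x \<in> pverts (H i)"
        with vs[OF i] show ?thesis by (auto simp: generalized_corona_def)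
      qed
    qed
    then show "a \<in> pverts ?C" "b \<in> pverts ?C" "a \<noteq> b" "(b, a) \<in> parcs ?C" by simp_all
  qed
  have "parcs ?C \<subseteq> pverts ?C \<times> pverts ?C"
    using wf by (intro subrelI) simp
  then have finA: "finite (parcs ?C)"
    by (rule finite_subset) (simp add: finV)
  show ?thesis
  proof unfold_locales
    show "symmetric ?C"
      using sym unfolding symmetric_def with_proj_simps by (intro symI)
  qed (use wf loop finV finA in auto)
qed

lemma det_shifted_char_mat:
  "det (shifted_char_mat \<alpha> H ws)
   = to_fract (pcompose (char_poly (A_alpha \<alpha> H ws)) [:- \<alpha>, 1:])"
proof -
  let ?n = "length ws" and ?A = "A_alpha \<alpha> H ws"
  let ?B = "map_mat (\<lambda>p. pcompose p [:- \<alpha>, 1:]) (char_poly_matrix ?A)"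
  interpret f: comm_ring_hom "to_fract :: real poly \<Rightarrow> ratfun"
    by unfold_locales (auto simp: to_fract_def One_fract_def Zero_fract_def)
  have s: "comm_ring_hom (\<lambda>p :: real poly. pcompose p [:- \<alpha>, 1:])"
    by unfold_locales (auto simp: pcompose_add pcompose_mult pcompose_1)
  have d: "dim_row ?A = ?n" "dim_col ?A = ?n"
    using A_alpha_carrier[of \<alpha> H ws] by (simp_all only: carrier_matD)
  have "shifted_char_mat \<alpha> H ws = map_mat to_fract ?B"
  proof (rule eq_matI)
    fix i j
    assume "i < dim_row (map_mat to_fract ?B)" and "j < dim_col (map_mat to_fract ?B)"
    then have ij: "i < ?n" "j < ?n"
      by (simp_all add: char_poly_matrix_def d)
    let ?p = "if i = j then [:- \<alpha>, 1:] else 0 :: real poly" and ?a = "[:?A $$ (i, j):]"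
    have "?B $$ (i, j) = ?p - ?a"
      using ij by (simp add: char_poly_matrix_def d pcompose_pCons)
    moreover have "map_mat to_fract ?B $$ (i, j) = to_fract (?B $$ (i, j))"
      using ij by (simp add: char_poly_matrix_def d)
    ultimately have "map_mat to_fract ?B $$ (i, j) = to_fract (?p - ?a)"
      by (simp only:)
    also have "?p - ?a = (if i = j then [:0, 1:] - [:\<alpha>:] else 0) - ?a"
      by simp
    also have "to_fract \<dots> = (if i = j then rf_var - rf_const \<alpha> else 0) - rf_const (?A $$ (i, j))"
      by (simp only: f.hom_minus if_distrib[of to_fract] f.hom_zero rf_var_def rf_const_def)
    also have "\<dots> = shifted_char_mat \<alpha> H ws $$ (i, j)"
      using ij by (simp add: shifted_char_mat_def d)
    finally show "shifted_char_mat \<alpha> H ws $$ (i, j) = map_mat to_fract ?B $$ (i, j)" ..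
  qed (simp_all add: shifted_char_mat_def char_poly_matrix_def d)
  then show ?thesis
    by (simp only: char_poly_def f.hom_det comm_ring_hom.hom_det[OF s])
qed

lemma mat_inverse_shifted_char_mat:
  obtains B where "mat_inverse (shifted_char_mat \<alpha> H ws) = Some B"
    and "inverts_mat (shifted_char_mat \<alpha> H ws) B"
    and "inverts_mat B (shifted_char_mat \<alpha> H ws)"
proof -
  let ?n = "length ws" and ?M = "shifted_char_mat \<alpha> H ws"
  have M: "?M \<in> carrier_mat ?n ?n"
    unfolding shifted_char_mat_def by (intro minus_carrier_mat) simp
  have "monic (char_poly (A_alpha \<alpha> H ws))"
    using degree_monic_char_poly[OF A_alpha_carrier[of \<alpha> H ws]] by simp
  then have "char_poly (A_alpha \<alpha> H ws) \<noteq> 0"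
    by auto
  then have "det ?M \<noteq> 0"
    by (simp add: det_shifted_char_mat pcompose_eq_0_iff)
  then have "?M \<in> Units (ring_mat TYPE(ratfun) ?n ())"
    by (rule det_non_zero_imp_unit[OF M])
  then obtain B where B: "mat_inverse ?M = Some B"
    using mat_inverse(1)[OF M, of "()"] by (cases "mat_inverse ?M") auto
  show thesis
    using that[OF B] mat_inverse(2)[OF M B] M by (auto simp: inverts_mat_def)
qed

end

theory Submission
  imports Defs
begin

text \<open>
  Let \<open>C\<close> be the corona and order its vertices so that the copy of \<open>G\<close> comes first and the copies of
  the \<open>H i\<close> follow one after the other. In \<open>\<lambda>I - A\<^sub>\<alpha>(C)\<close> a vertex of a copy of \<open>H i\<close> has
  degree one more than in \<open>H i\<close>, so the diagonal block of this copy is \<open>(\<lambda> - \<alpha>)I - A\<^sub>\<alpha>(H i)\<close>, whose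
  determinant is \<open>f(\<lambda> - \<alpha>)\<close> for the characteristic polynomial \<open>f\<close> of \<open>A\<^sub>\<alpha>(H i)\<close> and is not zero.
  Different copies are not adjacent, and the copy of \<open>H i\<close> meets the copy of \<open>G\<close> only in the row and
  the column of \<open>v\<^sub>i\<close>, where all entries are \<open>-(1 - \<alpha>)\<close>.
  
  Eliminating a nonsingular block by a Schur complement splits off its determinant and changes the
  remaining entries; since the blocks do not interact, they can be eliminated one by one, and their
  corrections to the block of \<open>G\<close> add up (\<open>det_mat_on_append_concat\<close>). The correction
  contributed by \<open>H i\<close> is \<open>(1 - \<alpha>)\<^sup>2 \<one>\<^sup>T((\<lambda> - \<alpha>)I - A\<^sub>\<alpha>(H i))\<^sup>-\<^sup>1\<one>\<close>, that is
  \<open>(1 - \<alpha>)\<^sup>2\<close> times the coronal, in the diagonal entry of \<open>v\<^sub>i\<close> and nowhere else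
  (\<open>schur_term_copy_enum\<close>). Together with the \<open>t i\<close> additional neighbours of \<open>v\<^sub>i\<close> this turns the
  block of \<open>G\<close> into the matrix whose determinant is \<open>g_A_alpha\<close> (\<open>det_corona_base\<close>).
  The given enumeration of the vertices of \<open>C\<close> does not matter, because permuting rows and columns
  simultaneously preserves the determinant (\<open>det_mat_on_permute\<close>).
\<close>

section \<open>Matrices indexed by lists of vertices\<close>

text \<open>
  Fixing the entry function \<open>f\<close> and letting the list vary makes it possible to reorder, split and
  restrict the index set without computing with positions: a principal submatrix is \<open>mat_on f\<close> of a
  shorter list.
\<close>

definition mat_on :: "('v \<Rightarrow> 'v \<Rightarrow> 'k) \<Rightarrow> 'v list \<Rightarrow> 'k mat" where
  "mat_on f xs = mat (length xs) (length xs) (\<lambda>(i, j). f (xs ! i) (xs ! j))"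

lemma mat_on_carrier [simp]: "mat_on f xs \<in> carrier_mat (length xs) (length xs)"
  by (simp add: mat_on_def)

lemma mat_on_cong:
  assumes "\<And>a b. a \<in> set xs \<Longrightarrow> b \<in> set xs \<Longrightarrow> f a b = g a b"
  shows "mat_on f xs = mat_on g xs"
  by (rule eq_matI) (auto simp: mat_on_def assms)

lemma mat_on_map: "mat_on f (map h xs) = mat_on (\<lambda>a b. f (h a) (h b)) xs"
  by (rule eq_matI) (auto simp: mat_on_def)

text \<open>
  The same permutation acts on rows and columns, so its sign enters twice and cancels.
\<close>

lemma det_mat_on_permute:
  fixes f :: "'v \<Rightarrow> 'v \<Rightarrow> 'k :: comm_ring_1"
  assumes "mset xs = mset ys"
  shows "det (mat_on f xs) = det (mat_on f ys)"
proof -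
  let ?n = "length ys"
  obtain p where p: "p permutes {..<?n}" and xs: "permute_list p ys = xs"
    using mset_eq_permutation[OF assms] .
  have p0: "p permutes {0..<?n}"
    using p by (simp add: atLeast0LessThan)
  have lt: "p i < ?n" if "i < ?n" for i
    using permutes_in_image[OF p] that by simp
  have sign: "signof p * signof p = (1 :: 'k)"
    by (metis mult_minus1_right mult_minus_right mult.right_neutral minus_minus sign_cases of_int_1 of_int_minus)
  define R where "R = mat ?n ?n (\<lambda>(i, j). mat_on f ys $$ (p i, j))"
  have R: "R \<in> carrier_mat ?n ?n"
    by (simp add: R_def)
  have "mat_on f xs = transpose_mat (mat ?n ?n (\<lambda>(i, j). transpose_mat R $$ (p i, j)))"
    unfolding xs[symmetric] R_def
    by (rule eq_matI) (auto simp: mat_on_def lt permute_list_nth[OF p])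
  also have "det \<dots> = signof p * det (transpose_mat R)"
    using R by (simp add: det_transpose[of _ ?n] det_permute_rows[OF _ p0])
  also have "\<dots> = signof p * (signof p * det (mat_on f ys))"
    unfolding det_transpose[OF R] unfolding R_def by (simp add: det_permute_rows[OF _ p0])
  also have "\<dots> = (signof p * signof p) * det (mat_on f ys)"
    by (simp only: mult.assoc)
  finally show ?thesis
    by (simp add: sign)
qed

section \<open>Eliminating independent blocks by Schur complements\<close>

lemma mat_inverse_of_det_nonzero:
  fixes N :: "'k :: field mat"
  assumes N: "N \<in> carrier_mat m m" and det: "det N \<noteq> 0"
  shows "the (mat_inverse N) \<in> carrier_mat m m" and "N * the (mat_inverse N) = 1\<^sub>m m"
proof -
  have "N \<in> Units (ring_mat TYPE('k) m ())"
    by (rule det_non_zero_imp_unit[OF N det])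
  then obtain B where B: "mat_inverse N = Some B"
    using mat_inverse(1)[OF N, of "()"] by (cases "mat_inverse N") auto
  show "the (mat_inverse N) \<in> carrier_mat m m" "N * the (mat_inverse N) = 1\<^sub>m m"
    using mat_inverse(2)[OF N B] B by simp_all
qed

text \<open>
  Multiplying on the right by a unipotent matrix, that is, adding combinations of the columns through
  \<open>D\<close> to the other columns, clears the block \<open>C\<close>.
\<close>

lemma det_schur_complement:
  fixes A B C D :: "'k :: field mat"
  assumes A: "A \<in> carrier_mat n n" and B: "B \<in> carrier_mat n m"
    and C: "C \<in> carrier_mat m n" and D: "D \<in> carrier_mat m m" and det: "det D \<noteq> 0"
  shows "det (four_block_mat A B C D) = det D * det (A - B * (the (mat_inverse D) * C))"
proof -
  define E where "E = the (mat_inverse D)"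
  have E: "E \<in> carrier_mat m m" and DE: "D * E = 1\<^sub>m m"
    unfolding E_def by (rule mat_inverse_of_det_nonzero[OF D det])+
  let ?M = "four_block_mat A B C D" and ?L = "four_block_mat (1\<^sub>m n) (0\<^sub>m n m) (- (E * C)) (1\<^sub>m m)"
  have EC: "E * C \<in> carrier_mat m n"
    using E C by simp
  have BEC: "B * (E * C) \<in> carrier_mat n n"
    using B EC by simp
  have DEC: "D * (E * C) = C"
    using assoc_mult_mat[OF D E C] C by (simp add: DE)
  have "?M * ?L = four_block_mat (A - B * (E * C)) B (0\<^sub>m m n) D"
  proof (subst mult_four_block_mat[OF A B C D])
    show "1\<^sub>m n \<in> carrier_mat n n" "0\<^sub>m n m \<in> carrier_mat n m" "- (E * C) \<in> carrier_mat m n" "1\<^sub>m m \<in> carrier_mat m m"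
      using EC by auto
    have "A * 1\<^sub>m n + B * - (E * C) = A - B * (E * C)"
      using A B EC uminus_mult_right_mat[of B "E * C"] minus_add_uminus_mat[of A n n "B * (E * C)"]
      by (simp add: carrier_matD[OF EC] del: index_mult_mat)
    moreover have "A * 0\<^sub>m n m + B * 1\<^sub>m m = B" "C * 0\<^sub>m n m + D * 1\<^sub>m m = D"
      using A B C D by simp_all
    moreover have "C * 1\<^sub>m n + D * - (E * C) = 0\<^sub>m m n"
      using C D DEC uminus_mult_right_mat[of D "E * C"]
      by (simp add: carrier_matD[OF EC] add_uminus_minus_mat[OF C C] del: index_mult_mat)
    ultimately show "four_block_mat (A * 1\<^sub>m n + B * - (E * C)) (A * 0\<^sub>m n m + B * 1\<^sub>m m)
        (C * 1\<^sub>m n + D * - (E * C)) (C * 0\<^sub>m n m + D * 1\<^sub>m m)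
      = four_block_mat (A - B * (E * C)) B (0\<^sub>m m n) D"
      by simp
  qed
  moreover have "det ?L = 1"
    using EC by (subst det_four_block_mat_upper_right_zero[where n = n and m = m]) auto
  moreover have "det (?M * ?L) = det ?M * det ?L"
    using A B C D EC by (intro det_mult[of _ "n + m"]) (auto intro!: four_block_carrier_mat)
  moreover have "det (four_block_mat (A - B * (E * C)) B (0\<^sub>m m n) D) = det (A - B * (E * C)) * det D"
    by (rule det_four_block_mat_lower_left_zero[OF minus_carrier_mat[OF BEC] B refl D])
  ultimately show ?thesis
    by (simp add: E_def mult.commute)
qed

text \<open>
  The amount subtracted from the entry at \<open>(a, b)\<close> when the block indexed by \<open>ys\<close> is eliminated.
\<close>

definition schur_term :: "('v \<Rightarrow> 'v \<Rightarrow> 'k :: field) \<Rightarrow> 'v list \<Rightarrow> 'v \<Rightarrow> 'v \<Rightarrow> 'k" where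
  "schur_term f ys a b =
     vec (length ys) (\<lambda>p. f a (ys ! p)) \<bullet>
       (the (mat_inverse (mat_on f ys)) *\<^sub>v vec (length ys) (\<lambda>q. f (ys ! q) b))"

lemma det_mat_on_append:
  fixes f :: "'v \<Rightarrow> 'v \<Rightarrow> 'k :: field"
  assumes det: "det (mat_on f ys) \<noteq> 0"
  shows "det (mat_on f (xs @ ys))
       = det (mat_on f ys) * det (mat_on (\<lambda>a b. f a b - schur_term f ys a b) xs)"
proof -
  let ?n = "length xs" and ?m = "length ys"
  let ?B = "mat ?n ?m (\<lambda>(i, j). f (xs ! i) (ys ! j))" and ?C = "mat ?m ?n (\<lambda>(i, j). f (ys ! i) (xs ! j))"
  define E where "E = the (mat_inverse (mat_on f ys))"
  have E: "E \<in> carrier_mat ?m ?m"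
    unfolding E_def by (rule mat_inverse_of_det_nonzero(1)[OF mat_on_carrier det])
  have "mat_on f (xs @ ys) = four_block_mat (mat_on f xs) ?B ?C (mat_on f ys)"
    by (rule eq_matI) (auto simp: mat_on_def nth_append)
  moreover have "mat_on f xs - ?B * (E * ?C) = mat_on (\<lambda>a b. f a b - schur_term f ys a b) xs"
  proof (rule eq_matI)
    fix i j
    assume "i < dim_row (mat_on (\<lambda>a b. f a b - schur_term f ys a b) xs)"
      and "j < dim_col (mat_on (\<lambda>a b. f a b - schur_term f ys a b) xs)"
    then have ij: "i < ?n" "j < ?n"
      by (simp_all add: mat_on_def)
    have "(?B * (E * ?C)) $$ (i, j) = row ?B i \<bullet> col (E * ?C) j"
      using ij E by simp
    also have "col (E * ?C) j = E *\<^sub>v col ?C j"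
      using ij E by (intro col_mult2) auto
    also have "row ?B i = vec ?m (\<lambda>p. f (xs ! i) (ys ! p))"
      using ij by (intro eq_vecI) auto
    also have "col ?C j = vec ?m (\<lambda>q. f (ys ! q) (xs ! j))"
      using ij by (intro eq_vecI) auto
    finally have "(?B * (E * ?C)) $$ (i, j) = schur_term f ys (xs ! i) (xs ! j)"
      by (simp add: schur_term_def E_def)
    then show "(mat_on f xs - ?B * (E * ?C)) $$ (i, j)
        = mat_on (\<lambda>a b. f a b - schur_term f ys a b) xs $$ (i, j)"
      using ij E by (simp add: mat_on_def)
  qed (use E in \<open>auto simp: mat_on_def\<close>)
  ultimately show ?thesis
    using det_schur_complement[OF mat_on_carrier[of f xs], of ?B ?m ?C "mat_on f ys"] det
    by (simp add: E_def)
qed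

text \<open>
  Eliminating a block leaves an entry unchanged unless both its row and its column meet the block;
  for this reason the elimination of one block does not disturb other blocks decoupled from it.
\<close>

lemma schur_term_eq_0:
  fixes f :: "'v \<Rightarrow> 'v \<Rightarrow> 'k :: field"
  assumes det: "det (mat_on f ys) \<noteq> 0"
    and zero: "(\<forall>y \<in> set ys. f a y = 0) \<or> (\<forall>y \<in> set ys. f y b = 0)"
  shows "schur_term f ys a b = 0"
proof -
  let ?m = "length ys"
  have E: "the (mat_inverse (mat_on f ys)) \<in> carrier_mat ?m ?m"
    by (rule mat_inverse_of_det_nonzero(1)[OF mat_on_carrier det])
  from zero have "vec ?m (\<lambda>p. f a (ys ! p)) = 0\<^sub>v ?m \<or> vec ?m (\<lambda>q. f (ys ! q) b) = 0\<^sub>v ?m"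
    by (auto intro: eq_vecI)
  then show ?thesis
    unfolding schur_term_def
  proof
    assume "vec ?m (\<lambda>p. f a (ys ! p)) = 0\<^sub>v ?m"
    then show "vec ?m (\<lambda>p. f a (ys ! p)) \<bullet> (the (mat_inverse (mat_on f ys)) *\<^sub>v vec ?m (\<lambda>q. f (ys ! q) b)) = 0"
      using E by (simp add: scalar_prod_left_zero[of _ ?m])
  next
    assume z: "vec ?m (\<lambda>q. f (ys ! q) b) = 0\<^sub>v ?m"
    have "the (mat_inverse (mat_on f ys)) *\<^sub>v 0\<^sub>v ?m = 0\<^sub>v ?m"
      using E by (intro eq_vecI) auto
    then show "vec ?m (\<lambda>p. f a (ys ! p)) \<bullet> (the (mat_inverse (mat_on f ys)) *\<^sub>v vec ?m (\<lambda>q. f (ys ! q) b)) = 0"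
      unfolding z by (simp add: scalar_prod_right_zero[of _ ?m])
  qed
qed

lemma schur_term_cong:
  assumes "\<And>y. y \<in> set ys \<Longrightarrow> f a y = g a y" and "\<And>y. y \<in> set ys \<Longrightarrow> f y b = g y b"
    and "\<And>y z. y \<in> set ys \<Longrightarrow> z \<in> set ys \<Longrightarrow> f y z = g y z"
  shows "schur_term f ys a b = schur_term g ys a b"
proof -
  have "mat_on f ys = mat_on g ys"
    by (rule mat_on_cong) (rule assms(3))
  moreover have "vec (length ys) (\<lambda>p. f a (ys ! p)) = vec (length ys) (\<lambda>p. g a (ys ! p))"
    "vec (length ys) (\<lambda>q. f (ys ! q) b) = vec (length ys) (\<lambda>q. g (ys ! q) b)"
    using assms(1,2) by (auto intro: eq_vecI)
  ultimately show ?thesis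
    by (simp add: schur_term_def)
qed

text \<open>
  The blocks are eliminated from the last to the first. By decoupling, an elimination affects neither
  the earlier blocks nor their rows and columns, so it also leaves their Schur terms as they were, and
  the corrections to the rows and columns in \<open>xs\<close> are simply summed. The entry function has to be
  arbitrary in the induction, since it changes with each elimination.
\<close>

lemma det_mat_on_append_concat:
  fixes f :: "'v \<Rightarrow> 'v \<Rightarrow> 'k :: field"
  assumes "\<And>ys. ys \<in> set yss \<Longrightarrow> det (mat_on f ys) \<noteq> 0"
    and "sorted_wrt (\<lambda>ys zs. \<forall>y \<in> set ys. \<forall>z \<in> set zs. f y z = 0 \<and> f z y = 0) yss"
  shows "det (mat_on f (xs @ concat yss))
       = (\<Prod>ys\<leftarrow>yss. det (mat_on f ys))
         * det (mat_on (\<lambda>a b. f a b - (\<Sum>ys\<leftarrow>yss. schur_term f ys a b)) xs)"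
  using assms
proof (induction yss arbitrary: f rule: rev_induct)
  case Nil
  then show ?case by simp
next
  case (snoc ys yss)
  define g where "g = (\<lambda>a b. f a b - schur_term f ys a b)"
  have det: "det (mat_on f ys) \<noteq> 0"
    using snoc.prems(1) by simp
  have fg: "g a z = f a z" "g z a = f z a" if "zs \<in> set yss" "z \<in> set zs" for zs z a
    using snoc.prems(2) that unfolding g_def
    by (auto simp: sorted_wrt_append intro!: schur_term_eq_0[OF det])
  have on: "mat_on g zs = mat_on f zs" if "zs \<in> set yss" for zs
    using fg[OF that] by (intro mat_on_cong) auto
  have sterm: "schur_term g zs a b = schur_term f zs a b" if "zs \<in> set yss" for zs a b
    using fg[OF that] by (intro schur_term_cong) auto
  have "sorted_wrt (\<lambda>ys zs. \<forall>y \<in> set ys. \<forall>z \<in> set zs. f y z = 0 \<and> f z y = 0) yss"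
    using snoc.prems(2) by (simp add: sorted_wrt_append)
  then have sorted: "sorted_wrt (\<lambda>ys zs. \<forall>y \<in> set ys. \<forall>z \<in> set zs. g y z = 0 \<and> g z y = 0) yss"
    by (rule sorted_wrt_mono_rel[rotated]) (auto simp: fg)
  have "det (mat_on f (xs @ concat (yss @ [ys]))) = det (mat_on f ys) * det (mat_on g (xs @ concat yss))"
    using det_mat_on_append[OF det, of "xs @ concat yss"] by (simp add: g_def)
  also have "det (mat_on g (xs @ concat yss)) = (\<Prod>zs\<leftarrow>yss. det (mat_on g zs))
      * det (mat_on (\<lambda>a b. g a b - (\<Sum>zs\<leftarrow>yss. schur_term g zs a b)) xs)"
    using snoc.prems(1) sorted by (intro snoc.IH) (auto simp: on)
  also have "(\<Prod>zs\<leftarrow>yss. det (mat_on g zs)) = (\<Prod>zs\<leftarrow>yss. det (mat_on f zs))"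
    by (simp add: on cong: map_cong)
  also have "(\<lambda>a b. g a b - (\<Sum>zs\<leftarrow>yss. schur_term g zs a b))
      = (\<lambda>a b. f a b - (\<Sum>zs\<leftarrow>yss @ [ys]. schur_term f zs a b))"
    by (simp add: sterm cong: map_cong) (simp add: g_def diff_diff_eq add.commute)
  finally show ?case
    by (simp add: mult_ac)
qed

section \<open>Characteristic matrices over the rational functions\<close>

lemma comm_ring_hom_to_fract: "comm_ring_hom (to_fract :: real poly \<Rightarrow> ratfun)"
  by unfold_locales (auto simp: to_fract_def One_fract_def Zero_fract_def)

lemma comm_ring_hom_rf_const: "comm_ring_hom rf_const"
proof -
  interpret f: comm_ring_hom "to_fract :: real poly \<Rightarrow> ratfun"
    by (rule comm_ring_hom_to_fract)
  show ?thesis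
  proof
    show "rf_const (a + b) = rf_const a + rf_const b" "rf_const (a * b) = rf_const a * rf_const b" for a b
      by (simp_all add: rf_const_def flip: f.hom_add f.hom_mult)
    show "rf_const 0 = 0" "rf_const 1 = 1"
      using f.hom_one by (simp_all add: rf_const_def one_pCons)
  qed
qed

interpretation rf_const: comm_ring_hom rf_const
  by (rule comm_ring_hom_rf_const)

lemma out_degree_with_proj: "out_degree (with_proj G) v = card {w. (v, w) \<in> parcs G}"
proof -
  have "out_arcs (with_proj G) v = Pair v ` {w. (v, w) \<in> parcs G}"
    by (auto simp: out_arcs_def)
  then show ?thesis
    by (simp add: out_degree_def card_image inj_on_def)
qed

lemma (in pair_graph) finite_pair_succs: "finite {w. (v, w) \<in> parcs G}"
  by (rule finite_subset[of _ "snd ` parcs G"]) (force simp: pair_finite_arcs)+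

definition A_alpha_entry :: "real \<Rightarrow> 'a pair_pre_digraph \<Rightarrow> 'a \<Rightarrow> 'a \<Rightarrow> real" where
  "A_alpha_entry \<alpha> G a b =
     (if a = b then \<alpha> * real (out_degree (with_proj G) a) else 0)
     + (if (a, b) \<in> parcs G then 1 - \<alpha> else 0)"

definition char_entry :: "real \<Rightarrow> 'a pair_pre_digraph \<Rightarrow> 'a \<Rightarrow> 'a \<Rightarrow> ratfun" where
  "char_entry \<alpha> G a b = (if a = b then rf_var else 0) - rf_const (A_alpha_entry \<alpha> G a b)"

lemma A_alpha_eq_mat_on:
  assumes "distinct vs"
  shows "A_alpha \<alpha> G vs = mat_on (A_alpha_entry \<alpha> G) vs"
  by (rule eq_matI)
    (use assms in \<open>auto simp: A_alpha_def degree_mat_def adjacency_mat_def mat_on_def mat_diag_def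
       A_alpha_entry_def nth_eq_iff_index_eq\<close>)

lemma to_fract_char_poly_A_alpha:
  assumes "distinct us"
  shows "to_fract (char_poly (A_alpha \<alpha> G us)) = det (mat_on (char_entry \<alpha> G) us)"
proof -
  interpret f: comm_ring_hom "to_fract :: real poly \<Rightarrow> ratfun"
    by (rule comm_ring_hom_to_fract)
  have "map_mat to_fract (char_poly_matrix (A_alpha \<alpha> G us)) = mat_on (char_entry \<alpha> G) us"
    unfolding A_alpha_eq_mat_on[OF assms]
  proof (rule eq_matI)
    fix i j
    assume "i < dim_row (mat_on (char_entry \<alpha> G) us)" "j < dim_col (mat_on (char_entry \<alpha> G) us)"
    then have ij: "i < length us" "j < length us"
      by (simp_all add: mat_on_def)
    let ?a = "A_alpha_entry \<alpha> G (us ! i) (us ! j)"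
    have "char_poly_matrix (mat_on (A_alpha_entry \<alpha> G) us) $$ (i, j) = (if i = j then [:0, 1:] else 0) - [:?a:]"
      using ij by (simp add: char_poly_matrix_def mat_on_def)
    moreover have "map_mat to_fract (char_poly_matrix (mat_on (A_alpha_entry \<alpha> G) us)) $$ (i, j)
        = to_fract (char_poly_matrix (mat_on (A_alpha_entry \<alpha> G) us) $$ (i, j))"
      using ij by (simp add: char_poly_matrix_def mat_on_def)
    ultimately have "map_mat to_fract (char_poly_matrix (mat_on (A_alpha_entry \<alpha> G) us)) $$ (i, j)
        = to_fract ((if i = j then [:0, 1:] else 0) - [:?a:])"
      by (simp only:)
    also have "\<dots> = (if i = j then rf_var else 0) - rf_const ?a"
      by (simp only: f.hom_minus if_distrib[of to_fract] f.hom_zero rf_var_def rf_const_def)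
    also have "\<dots> = mat_on (char_entry \<alpha> G) us $$ (i, j)"
      using ij assms by (simp add: mat_on_def char_entry_def nth_eq_iff_index_eq)
    finally show "map_mat to_fract (char_poly_matrix (mat_on (A_alpha_entry \<alpha> G) us)) $$ (i, j)
        = mat_on (char_entry \<alpha> G) us $$ (i, j)" .
  qed (simp_all add: char_poly_matrix_def mat_on_def)
  then show ?thesis
    by (simp add: char_poly_def flip: f.hom_det)
qed

lemma shifted_char_mat_eq_mat_on:
  assumes "distinct ws"
  shows "shifted_char_mat \<alpha> H ws
       = mat_on (\<lambda>x y. char_entry \<alpha> H x y - (if x = y then rf_const \<alpha> else 0)) ws"
  unfolding shifted_char_mat_def A_alpha_eq_mat_on[OF assms]
  by (rule eq_matI) (use assms in \<open>auto simp: mat_on_def char_entry_def nth_eq_iff_index_eq\<close>)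

lemma det_shifted_char_mat_nonzero: "det (shifted_char_mat \<alpha> H ws) \<noteq> 0"
proof -
  have "monic (char_poly (A_alpha \<alpha> H ws))"
    using degree_monic_char_poly[OF A_alpha_carrier[of \<alpha> H ws]] by simp
  then have "char_poly (A_alpha \<alpha> H ws) \<noteq> 0"
    by auto
  then show ?thesis
    by (simp add: det_shifted_char_mat pcompose_eq_0_iff)
qed

section \<open>Degrees and characteristic matrix of the corona\<close>

lemma parcs_generalized_corona:
  "(Inl u, Inl v) \<in> parcs (generalized_corona G vs H) \<longleftrightarrow> (u, v) \<in> parcs G"
  "(Inl u, Inr (i, x)) \<in> parcs (generalized_corona G vs H)
     \<longleftrightarrow> i < length vs \<and> u = vs ! i \<and> x \<in> pverts (H i)"
  "(Inr (i, x), Inl u) \<in> parcs (generalized_corona G vs H)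
     \<longleftrightarrow> i < length vs \<and> u = vs ! i \<and> x \<in> pverts (H i)"
  "(Inr (i, x), Inr (j, y)) \<in> parcs (generalized_corona G vs H)
     \<longleftrightarrow> i < length vs \<and> i = j \<and> (x, y) \<in> parcs (H i)"
  by (auto simp: generalized_corona_def)

lemma out_degree_generalized_corona_Inl:
  assumes "pair_graph G" and "distinct vs" and i: "i < length vs" and "pair_graph (H i)"
  shows "out_degree (with_proj (generalized_corona G vs H)) (Inl (vs ! i))
       = out_degree (with_proj G) (vs ! i) + card (pverts (H i))"
proof -
  interpret G: pair_graph G by fact
  interpret h: pair_graph "H i" by fact
  have "{w. (Inl (vs ! i), w) \<in> parcs (generalized_corona G vs H)}
      = Inl ` {w. (vs ! i, w) \<in> parcs G} \<union> (\<lambda>x. Inr (i, x)) ` pverts (H i)" (is "?S = ?A \<union> ?B")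
  proof (rule Set.set_eqI)
    fix w
    show "w \<in> ?S \<longleftrightarrow> w \<in> ?A \<union> ?B"
      by (cases w) (use i \<open>distinct vs\<close> in \<open>auto simp: parcs_generalized_corona nth_eq_iff_index_eq\<close>)
  qed
  moreover have "card (?A \<union> ?B) = card ?A + card ?B"
    using G.finite_pair_succs h.pair_finite_verts by (intro card_Un_disjoint) auto
  ultimately show ?thesis
    by (simp add: out_degree_with_proj card_image inj_on_def)
qed

lemma out_degree_generalized_corona_Inr:
  assumes i: "i < length vs" and "pair_graph (H i)" and x: "x \<in> pverts (H i)"
  shows "out_degree (with_proj (generalized_corona G vs H)) (Inr (i, x))
       = out_degree (with_proj (H i)) x + 1"
proof -
  interpret h: pair_graph "H i" by fact
  have "{w. (Inr (i, x), w) \<in> parcs (generalized_corona G vs H)}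
      = insert (Inl (vs ! i)) ((\<lambda>y. Inr (i, y)) ` {y. (x, y) \<in> parcs (H i)})" (is "?S = insert _ ?B")
  proof (rule Set.set_eqI)
    fix w
    show "w \<in> ?S \<longleftrightarrow> w \<in> insert (Inl (vs ! i)) ?B"
      by (cases w) (use i x in \<open>auto simp: parcs_generalized_corona\<close>)
  qed
  moreover have "card (insert (Inl (vs ! i)) ?B) = Suc (card ?B)"
    using h.finite_pair_succs by (intro card_insert_disjoint) auto
  ultimately show ?thesis
    by (simp add: out_degree_with_proj card_image inj_on_def)
qed

lemma char_entry_corona_base:
  assumes "pair_graph G" and "distinct vs" and "i < length vs" and "pair_graph (H i)" and "v = vs ! i"
  shows "char_entry \<alpha> (generalized_corona G vs H) (Inl u) (Inl v)
       = char_entry \<alpha> G u v - (if u = v then rf_const \<alpha> * of_nat (card (pverts (H i))) else 0)"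
  using out_degree_generalized_corona_Inl[of G vs i H, OF assms(1-4)] assms(5)
  by (auto simp: char_entry_def A_alpha_entry_def parcs_generalized_corona distrib_left
      rf_const.hom_add rf_const.hom_mult rf_const.hom_of_nat)

text \<open>
  The one additional neighbour of a vertex in a copy is what shifts \<open>\<lambda>\<close> to \<open>\<lambda> - \<alpha>\<close>.
\<close>

lemma char_entry_corona_copy:
  assumes "i < length vs" and "pair_graph (H i)" and "x \<in> pverts (H i)"
  shows "char_entry \<alpha> (generalized_corona G vs H) (Inr (i, x)) (Inr (i, y))
       = char_entry \<alpha> (H i) x y - (if x = y then rf_const \<alpha> else 0)"
  using out_degree_generalized_corona_Inr[of i vs H x G, OF assms] assms(1)
  by (auto simp: char_entry_def A_alpha_entry_def parcs_generalized_corona distrib_left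
      rf_const.hom_add)

lemma char_entry_corona_distinct_copies:
  assumes "i \<noteq> j"
  shows "char_entry \<alpha> (generalized_corona G vs H) (Inr (i, x)) (Inr (j, y)) = 0"
  using assms by (simp add: char_entry_def A_alpha_entry_def parcs_generalized_corona)

lemma char_entry_corona_joining:
  assumes "i < length vs" and "x \<in> pverts (H i)"
  shows "char_entry \<alpha> (generalized_corona G vs H) (Inl u) (Inr (i, x))
       = (if u = vs ! i then - (1 - rf_const \<alpha>) else 0)"
    and "char_entry \<alpha> (generalized_corona G vs H) (Inr (i, x)) (Inl u)
       = (if u = vs ! i then - (1 - rf_const \<alpha>) else 0)"
  using assms by (simp_all add: char_entry_def A_alpha_entry_def parcs_generalized_corona
      rf_const.hom_minus)

definition copy_enum :: "(nat \<Rightarrow> 'b list) \<Rightarrow> nat \<Rightarrow> ('a + nat \<times> 'b) list" where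
  "copy_enum ws i = map (\<lambda>x. Inr (i, x)) (ws i)"

lemma mat_on_copy_enum:
  assumes "i < length vs" and "pair_graph (H i)" and "vertex_enum (H i) (ws i)"
  shows "mat_on (char_entry \<alpha> (generalized_corona G vs H)) (copy_enum ws i)
       = shifted_char_mat \<alpha> (H i) (ws i)"
  using assms unfolding copy_enum_def mat_on_map vertex_enum_def
  by (simp add: shifted_char_mat_eq_mat_on)
    (intro mat_on_cong char_entry_corona_copy, auto)

text \<open>
  Both vectors coupling the copy to \<open>v\<^sub>i\<close> are \<open>-(1 - \<alpha>)\<close> times the all-ones vector, so the Schur
  term is a multiple of the coronal; every other vertex of \<open>G\<close> is decoupled from the copy.
\<close>

lemma schur_term_copy_enum:
  fixes G :: "'a pair_pre_digraph" and H :: "nat \<Rightarrow> 'b pair_pre_digraph" and ws :: "nat \<Rightarrow> 'b list"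
  assumes i: "i < length vs" and H: "pair_graph (H i)" and ws: "vertex_enum (H i) (ws i)"
  shows "schur_term (char_entry \<alpha> (generalized_corona G vs H)) (copy_enum ws i) (Inl u) (Inl v)
       = (if u = vs ! i \<and> v = vs ! i then (1 - rf_const \<alpha>)\<^sup>2 * coronal \<alpha> (H i) (ws i) else 0)"
proof -
  let ?f = "char_entry \<alpha> (generalized_corona G vs H)" and ?c = "- (1 - rf_const \<alpha>)"
    and ?m = "length (ws i)" and ?B = "copy_enum ws i :: ('a + nat \<times> 'b) list"
  have set: "set (ws i) = pverts (H i)"
    using ws by (simp add: vertex_enum_def)
  have copy: "mat_on ?f ?B = shifted_char_mat \<alpha> (H i) (ws i)"
    using assms by (rule mat_on_copy_enum)
  have det: "det (mat_on ?f ?B) \<noteq> 0"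
    by (simp add: copy det_shifted_char_mat_nonzero)
  show ?thesis
  proof (cases "u = vs ! i \<and> v = vs ! i")
    case True
    have E: "the (mat_inverse (mat_on ?f ?B)) \<in> carrier_mat ?m ?m"
      using mat_inverse_of_det_nonzero(1)[OF mat_on_carrier det] by (metis copy_enum_def length_map)
    have "vec (length ?B) (\<lambda>p. ?f (Inl u) (?B ! p)) = ?c \<cdot>\<^sub>v all_ones ?m"
      "vec (length ?B) (\<lambda>q. ?f (?B ! q) (Inl v)) = ?c \<cdot>\<^sub>v all_ones ?m"
      using True i nth_mem[of _ "ws i"]
      by (auto simp: copy_enum_def all_ones_def char_entry_corona_joining set intro!: eq_vecI)
    then have "schur_term ?f ?B (Inl u) (Inl v) = (?c \<cdot>\<^sub>v all_ones ?m) \<bullet>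
        (the (mat_inverse (shifted_char_mat \<alpha> (H i) (ws i))) *\<^sub>v (?c \<cdot>\<^sub>v all_ones ?m))"
      by (simp add: schur_term_def copy)
    also have "\<dots> = ?c * (?c * coronal \<alpha> (H i) (ws i))"
      using E unfolding coronal_def copy
      by (subst mult_mat_vec[of _ ?m ?m]) (auto simp: all_ones_def)
    finally show ?thesis
      using True by (simp add: power2_eq_square algebra_simps)
  next
    case False
    have "schur_term ?f ?B (Inl u) (Inl v) = 0"
      by (rule schur_term_eq_0[OF det])
        (use False in \<open>auto simp: copy_enum_def char_entry_corona_joining[OF i] set\<close>)
    with False show ?thesis
      by auto
  qed
qed

section \<open>The determinant of the corona\<close>

lemma distinct_concat_copy_enum:
  assumes "\<And>i. i < k \<Longrightarrow> distinct (ws i)"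
  shows "distinct (concat (map (copy_enum ws) [0..<k]))"
  using assms by (induction k) (auto simp: copy_enum_def distinct_map inj_on_def)

lemma mset_corona_enum:
  assumes "vertex_enum G vs" and "\<And>i. i < length vs \<Longrightarrow> vertex_enum (H i) (ws i)"
    and "vertex_enum (generalized_corona G vs H) us"
  shows "mset us = mset (map Inl vs @ concat (map (copy_enum ws) [0..<length vs]))"
proof -
  have "distinct (map Inl vs @ concat (map (copy_enum ws) [0..<length vs]))"
    using assms(1,2) distinct_concat_copy_enum[of "length vs" ws]
    by (auto simp: vertex_enum_def distinct_map copy_enum_def)
  moreover have "set us = set (map Inl vs @ concat (map (copy_enum ws) [0..<length vs]))"
    using assms by (auto simp: vertex_enum_def generalized_corona_def copy_enum_def)
  ultimately show ?thesis
    using assms(3) set_eq_iff_mset_eq_distinct unfolding vertex_enum_def by blast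
qed

lemma det_corona_base:
  fixes \<alpha> :: real
  assumes G: "pair_graph G" and vs: "vertex_enum G vs"
    and H: "\<And>i. i < length vs \<Longrightarrow> pair_graph (H i)"
    and t: "\<And>i. i < length vs \<Longrightarrow> card (pverts (H i)) = t i"
    and ws: "\<And>i. i < length vs \<Longrightarrow> vertex_enum (H i) (ws i)"
  defines "f \<equiv> char_entry \<alpha> (generalized_corona G vs H)"
  shows "det (mat_on (\<lambda>a b. f a b - (\<Sum>ys\<leftarrow>map (copy_enum ws) [0..<length vs]. schur_term f ys a b)) (map Inl vs))
       = g_A_alpha \<alpha> t (\<lambda>i. coronal \<alpha> (H i) (ws i)) G vs"
proof -
  let ?n = "length vs" and ?\<chi> = "\<lambda>i. coronal \<alpha> (H i) (ws i)"
  have d: "distinct vs"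
    using vs by (simp add: vertex_enum_def)
  let ?h = "\<lambda>u v. f (Inl u) (Inl v) - (\<Sum>ys\<leftarrow>map (copy_enum ws) [0..<?n]. schur_term f ys (Inl u) (Inl v))"
  have entry: "?h (vs ! p) (vs ! q) = char_entry \<alpha> G (vs ! p) (vs ! q)
      - (if p = q then rf_const \<alpha> * of_nat (t p) + (1 - rf_const \<alpha>)\<^sup>2 * ?\<chi> p else 0)"
    if p: "p < ?n" and q: "q < ?n" for p q
  proof -
    have "(\<Sum>ys\<leftarrow>map (copy_enum ws) [0..<?n]. schur_term f ys (Inl (vs ! p)) (Inl (vs ! q)))
        = (\<Sum>i\<in>{0..<?n}. schur_term f (copy_enum ws i) (Inl (vs ! p)) (Inl (vs ! q)))"
      by (simp add: sum_list_distinct_conv_sum_set o_def)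
    also have "\<dots> = (\<Sum>i\<in>{0..<?n}. if i = p then (if p = q then (1 - rf_const \<alpha>)\<^sup>2 * ?\<chi> p else 0) else 0)"
      unfolding f_def
      by (intro sum.cong refl) (use d p q in \<open>auto simp: schur_term_copy_enum[of _ vs H ws] H ws nth_eq_iff_index_eq\<close>)
    also have "\<dots> = (if p = q then (1 - rf_const \<alpha>)\<^sup>2 * ?\<chi> p else 0)"
      using p by simp
    finally show ?thesis
      using char_entry_corona_base[of G vs q H "vs ! q" \<alpha> "vs ! p", OF G d q H[OF q] refl] p q d t[OF q]
      by (simp add: f_def nth_eq_iff_index_eq)
  qed
  have "mat_on ?h vs = mat_diag ?n (\<lambda>i. rf_var - rf_const \<alpha> * of_nat (t i) - (1 - rf_const \<alpha>)\<^sup>2 * ?\<chi> i)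
      - map_mat rf_const (A_alpha \<alpha> G vs)"
    unfolding A_alpha_eq_mat_on[OF d]
  proof (rule eq_matI, goal_cases)
    case (1 i j)
    then have ij: "i < ?n" "j < ?n"
      by (simp_all add: mat_on_def)
    have "mat_on ?h vs $$ (i, j) = ?h (vs ! i) (vs ! j)"
      using ij by (simp add: mat_on_def)
    then show ?case
      unfolding entry[OF ij] using ij d
      by (simp add: mat_on_def mat_diag_def char_entry_def nth_eq_iff_index_eq)
  qed (simp_all add: mat_on_def mat_diag_def)
  then show ?thesis
    by (simp only: mat_on_map g_A_alpha_def)
qed

theorem theorem3p1:
  fixes G :: "'a pair_pre_digraph" and vs :: "'a list" and n :: nat
    and H :: "nat \<Rightarrow> 'b pair_pre_digraph" and ws :: "nat \<Rightarrow> 'b list" and t :: "nat \<Rightarrow> nat"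
    and us :: "('a + nat \<times> 'b) list" and \<alpha> :: real
  assumes "pair_graph G" and "card (pverts G) = n" and "vertex_enum G vs"
    and "\<And>i. i < n \<Longrightarrow> pair_graph (H i)"
    and "\<And>i. i < n \<Longrightarrow> card (pverts (H i)) = t i"
    and "\<And>i. i < n \<Longrightarrow> vertex_enum (H i) (ws i)"
    and "vertex_enum (generalized_corona G vs H) us"
    and "0 \<le> \<alpha>" and "\<alpha> \<le> 1"
  shows "to_fract (char_poly (A_alpha \<alpha> (generalized_corona G vs H) us))
       = (\<Prod>i<n. to_fract (pcompose (char_poly (A_alpha \<alpha> (H i) (ws i))) [:- \<alpha>, 1:]))
         * g_A_alpha \<alpha> t (\<lambda>i. coronal \<alpha> (H i) (ws i)) G vs"
proof -
  let ?f = "char_entry \<alpha> (generalized_corona G vs H)"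
  let ?blocks = "map (copy_enum ws) [0..<n] :: ('a + nat \<times> 'b) list list"
  have n: "n = length vs"
    using assms(2,3) distinct_card[of vs] by (simp add: vertex_enum_def)
  have block: "mat_on ?f (copy_enum ws i) = shifted_char_mat \<alpha> (H i) (ws i)" if "i < n" for i
    using assms(4,6) that by (intro mat_on_copy_enum) (auto simp: n)
  have "to_fract (char_poly (A_alpha \<alpha> (generalized_corona G vs H) us)) = det (mat_on ?f us)"
    using assms(7) by (intro to_fract_char_poly_A_alpha) (simp add: vertex_enum_def)
  also have "\<dots> = det (mat_on ?f (map Inl vs @ concat ?blocks))"
    using mset_corona_enum[OF assms(3) _ assms(7)] assms(6) unfolding n by (intro det_mat_on_permute) auto
  also have "\<dots> = (\<Prod>ys\<leftarrow>?blocks. det (mat_on ?f ys))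
      * det (mat_on (\<lambda>a b. ?f a b - (\<Sum>ys\<leftarrow>?blocks. schur_term ?f ys a b)) (map Inl vs))"
  proof (rule det_mat_on_append_concat)
    show "det (mat_on ?f ys) \<noteq> 0" if "ys \<in> set ?blocks" for ys
      using that by (auto simp: block det_shifted_char_mat_nonzero)
    show "sorted_wrt (\<lambda>ys zs. \<forall>y \<in> set ys. \<forall>z \<in> set zs. ?f y z = 0 \<and> ?f z y = 0) ?blocks"
      by (auto simp: sorted_wrt_iff_nth_less copy_enum_def char_entry_corona_distinct_copies)
  qed
  also have "(\<Prod>ys\<leftarrow>?blocks. det (mat_on ?f ys))
      = (\<Prod>i<n. to_fract (pcompose (char_poly (A_alpha \<alpha> (H i) (ws i))) [:- \<alpha>, 1:]))"
    by (simp add: o_def prod.distinct_set_conv_list[symmetric] block lessThan_atLeast0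
        flip: det_shifted_char_mat)
  also have "det (mat_on (\<lambda>a b. ?f a b - (\<Sum>ys\<leftarrow>?blocks. schur_term ?f ys a b)) (map Inl vs))
      = g_A_alpha \<alpha> t (\<lambda>i. coronal \<alpha> (H i) (ws i)) G vs"
    using assms unfolding n by (intro det_corona_base) auto
  finally show ?thesis .
qed

end
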